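(* For every integer $n \geq 2$, the hypothesis class $\mathcal{H}'_{\leq n} = \{h_p : p \text{ is prime},\ p \leq n\}$ satisfies \[ \mathrm{VCdim}(\mathcal{H}'_{\leq n}) = \lfloor \log_2 \pi(n) \rfloor . \]
   Context: Let $\mathcal{X} = \{n \in \mathbb{N} : n \geq 2\}$, where $\mathbb{N}$ is the set of positive integers. For a prime $p$ define $h_p : \mathcal{X} \to \{0,1\}$ by $h_p(x) = 1$ if $x \leq p$ or $p \nmid x$, and $h_p(x) = 0$ otherwise (so $h_p(x) = 0$ if and only if $p \mid x$ and $x > p$). $\pi(n)$ denotes the number of primes less than or equal to $n$. A class $\mathcal{G}$ of functions $g : \mathcal{X} \to \{0,1\}$ shatters a set $C = \{c_1, \dots, c_\ell\} \subset \mathcal{X}$ of $\ell$ distinct elements if $\big|\{(g(c_1), \dots, g(c_\ell)) : g \in \mathcal{G}\}\big| = 2^\ell$ (the empty set is shattered by any nonempty class). The VC-dimension $\mathrm{VCdim}(\mathcal{G})$ is the size of the largest set that $\mathcal{G}$ shatters. *)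

theory Defs
  imports Complex_Main "HOL-Library.FuncSet" "HOL-Library.Extended_Nat"
    "HOL-Computational_Algebra.Primes"
begin

definition dom_X :: "nat set" where
  "dom_X = {n. n \<ge> 2}"

text \<open>A function from \<open>dom_X\<close> to \<open>{0, 1}\<close> is an element of \<open>dom_X \<rightarrow>\<^sub>E {0, 1}\<close>: it takes
  the value \<open>undefined\<close> off \<open>dom_X\<close>, so that equality of such functions is equality on \<open>dom_X\<close>.\<close>

definition hyp :: "nat \<Rightarrow> nat \<Rightarrow> nat" where
  "hyp p = (\<lambda>x\<in>dom_X. if x \<le> p \<or> \<not> p dvd x then 1 else 0)"

definition hyp_class :: "nat \<Rightarrow> (nat \<Rightarrow> nat) set" where
  "hyp_class n = {hyp p |p. prime p \<and> p \<le> n}"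

lemma hyp_class_subset: "hyp_class n \<subseteq> dom_X \<rightarrow>\<^sub>E {0, 1}"
  by (auto simp: hyp_class_def hyp_def)

text \<open>The vector \<open>(g c\<^sub>1, \<dots>, g c\<^sub>l)\<close> is encoded by the restriction of \<open>g\<close> to
  \<open>C = {c\<^sub>1, \<dots>, c\<^sub>l}\<close>. The notion is meant for classes \<open>G \<subseteq> dom_X \<rightarrow>\<^sub>E {0, 1}\<close>.\<close>

definition shatters :: "(nat \<Rightarrow> nat) set \<Rightarrow> nat set \<Rightarrow> bool" where
  "shatters G C \<longleftrightarrow> finite C \<and> C \<subseteq> dom_X \<and> card ((\<lambda>g. restrict g C) ` G) = 2 ^ card C"

text \<open>The supremum is the maximum when the sizes of shattered sets are bounded, and \<open>\<infinity>\<close>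
  otherwise.\<close>

definition VCdim :: "(nat \<Rightarrow> nat) set \<Rightarrow> enat" where
  "VCdim G = (SUP C\<in>{C. shatters G C}. enat (card C))"

definition prime_pi :: "nat \<Rightarrow> nat" where
  "prime_pi n = card {p. prime p \<and> p \<le> n}"

end

theory Submission
  imports Defs
begin

text \<open>
  The class has at most \<open>prime_pi n\<close> members, and a shattered set \<open>C\<close> needs \<open>2 ^ card C\<close> of
  them; this gives the upper bound. For the lower bound let \<open>2 ^ k \<le> prime_pi n\<close> and label
  the subsets \<open>S\<close> of \<open>{..<k}\<close> injectively by primes \<open>P S \<le> n\<close>. The points
  \<open>c i = (\<Prod>S | S \<subseteq> {..<k} \<and> i \<in> S. P S)\<^sup>2\<close> then
  record membership: \<open>P S\<close> divides \<open>c i\<close> exactly when \<open>i \<in> S\<close>, so \<open>hyp (P S)\<close> vanishes at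
  precisely the \<open>c i\<close> with \<open>i \<in> S\<close>, and every pattern on the \<open>k\<close> points occurs. Squaring
  makes each \<open>c i\<close> exceed all of its prime divisors, which deals with the exception \<open>x \<le> p\<close>
  in \<open>hyp p x\<close>; without the square it would strike for \<open>k = 1\<close>, where the product is a
  single prime.
\<close>

lemma finite_primes_le: "finite {p::nat. prime p \<and> p \<le> n}"
  by (rule finite_subset[of _ "{..n}"]) auto

lemma hyp_class_eq_image: "hyp_class n = hyp ` {p. prime p \<and> p \<le> n}"
  by (auto simp: hyp_class_def)

lemma shatters_imp_pow_card_le:
  assumes "shatters G C" "finite G"
  shows "2 ^ card C \<le> card G"
  using assms card_image_le[of G "\<lambda>g. restrict g C"] by (simp add: shatters_def)

text \<open>There are only \<open>2 ^ card C\<close> patterns on \<open>C\<close> at all, so it suffices to exhibit for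
  every subset \<open>S\<close> of an index set a member of \<open>G\<close> that vanishes exactly at the points
  indexed by \<open>S\<close>.\<close>

lemma shattersI_zero_sets:
  assumes G: "G \<subseteq> dom_X \<rightarrow>\<^sub>E {0, 1}"
    and I: "finite I" and c: "inj_on c I" "c ` I \<subseteq> dom_X"
    and g: "\<And>S. S \<subseteq> I \<Longrightarrow> g S \<in> G"
    and zero: "\<And>S i. S \<subseteq> I \<Longrightarrow> i \<in> I \<Longrightarrow> g S (c i) = 0 \<longleftrightarrow> i \<in> S"
  shows "shatters G (c ` I)"
proof -
  let ?C = "c ` I"
  let ?R = "(\<lambda>h. restrict h ?C) ` G"
  have sub: "?R \<subseteq> ?C \<rightarrow>\<^sub>E {0, 1}"
  proof (rule image_subsetI)
    fix h assume "h \<in> G"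
    then have "h \<in> dom_X \<rightarrow>\<^sub>E {0, 1}"
      using G by blast
    then show "restrict h ?C \<in> ?C \<rightarrow>\<^sub>E {0, 1}"
      using c(2) by (fastforce simp: restrict_PiE_iff dest: PiE_mem)
  qed
  have fin: "finite (?C \<rightarrow>\<^sub>E {0, 1::nat})"
    using I by (intro finite_PiE) auto
  have "card ?R \<le> card (?C \<rightarrow>\<^sub>E {0, 1::nat})"
    using fin sub by (rule card_mono)
  also have "\<dots> = 2 ^ card ?C"
    using I by (simp add: card_PiE numeral_2_eq_2)
  finally have upper: "card ?R \<le> 2 ^ card ?C" .
  have "inj_on (\<lambda>S. restrict (g S) ?C) (Pow I)"
  proof (rule inj_onI)
    fix S T
    assume ST: "S \<in> Pow I" "T \<in> Pow I" and eq: "restrict (g S) ?C = restrict (g T) ?C"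
    have "i \<in> S \<longleftrightarrow> i \<in> T" if "i \<in> I" for i
    proof -
      have "g S (c i) = g T (c i)"
        using fun_cong[OF eq, of "c i"] that by simp
      then show ?thesis
        using zero[of S i] zero[of T i] ST that by simp
    qed
    then show "S = T"
      using ST by auto
  qed
  then have "card ((\<lambda>S. restrict (g S) ?C) ` Pow I) = card (Pow I)"
    by (rule card_image)
  also have "\<dots> = 2 ^ card ?C"
    using I c(1) by (simp add: card_Pow card_image)
  finally have "2 ^ card ?C = card ((\<lambda>S. restrict (g S) ?C) ` Pow I)" ..
  also have "\<dots> \<le> card ?R"
    using g finite_subset[OF sub fin] by (intro card_mono) auto
  finally have "card ?R = 2 ^ card ?C"
    using upper by simp
  then show ?thesis
    using I c(2) by (simp add: shatters_def)
qed

lemma square_prod_primes_in_dom_X: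
  fixes A :: "nat set"
  assumes "finite A" "A \<noteq> {}" "\<And>q. q \<in> A \<Longrightarrow> prime q"
  shows "(\<Prod>A)\<^sup>2 \<in> dom_X"
proof -
  obtain q where q: "q \<in> A"
    using assms(2) by blast
  have "q dvd \<Prod>A"
    using assms(1) q dvd_prodI[of A _ "\<lambda>x. x"] by simp
  moreover have "\<Prod>A \<noteq> 0"
    using assms(1) assms(3)[of 0] by auto
  ultimately have "q \<le> \<Prod>A"
    by (simp add: dvd_imp_le)
  then have "2 \<le> \<Prod>A"
    using prime_ge_2_nat[OF assms(3)[OF q]] by simp
  then show ?thesis
    using self_le_power[of "\<Prod>A" 2] by (simp add: dom_X_def)
qed

lemma hyp_square_prod_primes_eq_0_iff:
  fixes A :: "nat set"
  assumes A: "finite A" "A \<noteq> {}" "\<And>q. q \<in> A \<Longrightarrow> prime q" and p: "prime p"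
  shows "hyp p ((\<Prod>A)\<^sup>2) = 0 \<longleftrightarrow> p \<in> A"
proof -
  have dvd: "p dvd (\<Prod>A)\<^sup>2 \<longleftrightarrow> p \<in> A"
  proof
    assume "p dvd (\<Prod>A)\<^sup>2"
    then have "p dvd \<Prod>A"
      using p by (rule prime_dvd_power[rotated])
    then obtain q where "q \<in> A" "p dvd q"
      using prime_dvd_prod_iff[OF A(1) p, of "\<lambda>x. x"] by auto
    then show "p \<in> A"
      using A(3) p primes_dvd_imp_eq by blast
  next
    assume "p \<in> A"
    then have "p dvd \<Prod>A"
      using A(1) dvd_prodI[of A _ "\<lambda>x. x"] by simp
    then show "p dvd (\<Prod>A)\<^sup>2"
      by (simp add: power2_eq_square)
  qed
  have large: "p < (\<Prod>A)\<^sup>2" if "p \<in> A"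
  proof -
    have "p dvd \<Prod>A"
      using A(1) that dvd_prodI[of A _ "\<lambda>x. x"] by simp
    then have "p\<^sup>2 dvd (\<Prod>A)\<^sup>2"
      by simp
    moreover have "(\<Prod>A)\<^sup>2 > 0"
      using square_prod_primes_in_dom_X[OF A] unfolding dom_X_def mem_Collect_eq by linarith
    ultimately have "p\<^sup>2 \<le> (\<Prod>A)\<^sup>2"
      by (rule dvd_imp_le)
    moreover have "p < p\<^sup>2"
      using prime_gt_1_nat[OF p] by (simp add: power2_eq_square)
    ultimately show ?thesis
      by linarith
  qed
  show ?thesis
    using square_prod_primes_in_dom_X[OF A] dvd large by (auto simp: hyp_def)
qed

lemma ex_shattered_by_hyp_class:
  assumes "2 ^ k \<le> prime_pi n"
  shows "\<exists>C. shatters (hyp_class n) C \<and> card C = k"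
proof -
  let ?I = "{..<k}"
  have "card (Pow ?I) \<le> card {p. prime p \<and> p \<le> n}"
    using assms by (simp add: card_Pow prime_pi_def)
  then obtain P where P: "P ` Pow ?I \<subseteq> {p. prime p \<and> p \<le> n}" "inj_on P (Pow ?I)"
    using card_le_inj[of "Pow ?I" "{p. prime p \<and> p \<le> n}"] finite_primes_le by auto
  define A where "A i = P ` {S. S \<subseteq> ?I \<and> i \<in> S}" for i
  define c where "c i = (\<Prod>(A i))\<^sup>2" for i
  have finA: "finite (A i)" for i
    unfolding A_def by (rule finite_imageI, rule finite_subset[of _ "Pow ?I"]) auto
  have neA: "A i \<noteq> {}" if "i \<in> ?I" for i
    using that by (auto simp: A_def)
  have primeA: "prime q" if "q \<in> A i" for i q
    using that P(1) by (auto simp: A_def)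
  have prime_P: "prime (P S)" if "S \<subseteq> ?I" for S
    using that P(1) by auto
  have mem_A: "P S \<in> A i \<longleftrightarrow> i \<in> S" if "S \<subseteq> ?I" for S i
    using that by (auto simp: A_def inj_on_eq_iff[OF P(2)] inj_on_image_mem_iff[OF P(2)])
  have zero: "hyp (P S) (c i) = 0 \<longleftrightarrow> i \<in> S" if "S \<subseteq> ?I" "i \<in> ?I" for S i
    using hyp_square_prod_primes_eq_0_iff[OF finA neA[OF that(2)] primeA prime_P[OF that(1)]]
      mem_A[OF that(1)] by (simp add: c_def)
  have inj: "inj_on c ?I"
  proof (rule inj_onI)
    fix i j
    assume ij: "i \<in> ?I" "j \<in> ?I" "c i = c j"
    \<comment> \<open>The label of the singleton \<open>{i}\<close> tells \<open>c i\<close> from the other points.\<close>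
    have "hyp (P {i}) (c j) = 0"
      using zero[of "{i}" i] ij by simp
    then show "i = j"
      using zero[of "{i}" j] ij by simp
  qed
  have "c ` ?I \<subseteq> dom_X"
    using square_prod_primes_in_dom_X[OF finA neA primeA] by (auto simp: c_def)
  moreover have "hyp (P S) \<in> hyp_class n" if "S \<subseteq> ?I" for S
    using that P(1) unfolding hyp_class_eq_image by blast
  ultimately have "shatters (hyp_class n) (c ` ?I)"
    using zero
    by (intro shattersI_zero_sets[OF hyp_class_subset _ inj, where g = "\<lambda>S. hyp (P S)"]) auto
  then show ?thesis
    using card_image[OF inj] by auto
qed

lemma le_floor_log2_iff:
  assumes "m > 0"
  shows "d \<le> nat \<lfloor>log 2 (real m)\<rfloor> \<longleftrightarrow> 2 ^ d \<le> m"
proof -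
  have "0 \<le> \<lfloor>log 2 (real m)\<rfloor>"
    using assms by simp
  then have "d \<le> nat \<lfloor>log 2 (real m)\<rfloor> \<longleftrightarrow> real d \<le> log 2 (real m)"
    by (simp add: le_nat_iff le_floor_iff)
  also have "\<dots> \<longleftrightarrow> 2 powr real d \<le> real m"
    using assms by (simp add: le_log_iff)
  also have "\<dots> \<longleftrightarrow> real (2 ^ d) \<le> real m"
    by (simp add: powr_realpow)
  finally show ?thesis
    by (simp only: of_nat_le_iff)
qed

theorem corollary1p3:
  fixes n :: nat
  assumes "n \<ge> 2"
  shows "VCdim (hyp_class n) = enat (nat \<lfloor>log 2 (real (prime_pi n))\<rfloor>)"
proof -
  let ?k = "nat \<lfloor>log 2 (real (prime_pi n))\<rfloor>"
  have "2 \<in> {p. prime p \<and> p \<le> n}"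
    using assms by simp
  then have pos: "prime_pi n > 0"
    unfolding prime_pi_def using finite_primes_le card_gt_0_iff by blast
  have card_class: "card (hyp_class n) \<le> prime_pi n"
    unfolding hyp_class_eq_image prime_pi_def by (rule card_image_le[OF finite_primes_le])
  have fin_class: "finite (hyp_class n)"
    unfolding hyp_class_eq_image by (rule finite_imageI[OF finite_primes_le])
  have upper: "card C \<le> ?k" if "shatters (hyp_class n) C" for C
    using shatters_imp_pow_card_le[OF that fin_class] card_class le_floor_log2_iff[OF pos]
    by (meson order_trans)
  obtain C where C: "shatters (hyp_class n) C" "card C = ?k"
    using ex_shattered_by_hyp_class le_floor_log2_iff[OF pos] by blast
  show ?thesis
    unfolding VCdim_def
  proof (rule antisym)
    show "(SUP C\<in>{C. shatters (hyp_class n) C}. enat (card C)) \<le> enat ?k"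
      using upper by (intro SUP_least) simp
    show "enat ?k \<le> (SUP C\<in>{C. shatters (hyp_class n) C}. enat (card C))"
      using C by (intro SUP_upper2[of C]) auto
  qed
qed

end
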